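(* Let $n\ge 1$, let $P_i\in \boldsymbol{B_1}$ for $i=0,1,\dots,n$ and let $f\in\boldsymbol{B_2}$. Suppose that for every $\phi\in M[a,b]$ and every $x\in[a,b]$ $$\sum_{i=1}^{n} P_i(x)\,\partial_x^{\,i}\phi(x)+P_0(x)\phi(x)+\int_a^x f(x,z)\,\phi(z)\,dz=0 .$$ Then $P_i(x)=0$ for all $x\in[a,b]$ and all $i=0,1,\dots,n$, and $f(x,y)=0$ for all $(x,y)\in\Delta$.
   Context: Fix real numbers $a<b$. $\boldsymbol{B_1}$ is the algebra of smooth functions $P:[a,b]\to\mathbb C$. $\Delta=\{(x,y): a\le y\le x\le b\}$, and $\boldsymbol{B_2}$ is the algebra of smooth functions $f:\Delta\to\mathbb C$ (all partial derivatives of all orders exist and are continuous on the closed triangle $\Delta$). $M[a,b]$ is the vector space of all smooth functions $\phi:[a,b]\to\mathbb C$ with $\phi(a)=0$ and $\frac{d^k\phi}{dx^k}(a)=0$ for all $k\ge 1$. *)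

theory Defs
  imports "HOL-Analysis.Analysis"
begin

text \<open>
  Functions on \<open>[a,b]\<close> and on the triangle are total functions of which only the values on that
  set matter: derivatives are taken within the set, hence one-sided at its boundary.
\<close>

definition deriv_on :: "real \<Rightarrow> real \<Rightarrow> nat \<Rightarrow> (real \<Rightarrow> complex) \<Rightarrow> real \<Rightarrow> complex" where
  "deriv_on a b k \<phi> = ((\<lambda>g x. vector_derivative g (at x within {a..b})) ^^ k) \<phi>"

definition B1 :: "real \<Rightarrow> real \<Rightarrow> (real \<Rightarrow> complex) set" where
  "B1 a b = {P. \<forall>k. deriv_on a b k P differentiable_on {a..b}}"

definition Delta :: "real \<Rightarrow> real \<Rightarrow> (real \<times> real) set" where
  "Delta a b = {(x, y). a \<le> y \<and> y \<le> x \<and> x \<le> b}"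

text \<open>
  \<open>D i j\<close> is the partial derivative of \<open>f\<close> of order \<open>i\<close> in \<open>x\<close> and \<open>j\<close> in \<open>y\<close> (the order of
  differentiation is irrelevant because all of them are continuous). Each is taken along the
  horizontal or vertical slice of the triangle. The horizontal slice through \<open>(b,b)\<close> and the
  vertical slice through \<open>(a,a)\<close> are single points; there the derivative condition is void and the
  value of the partial derivative is the one determined by continuity.
\<close>

definition B2 :: "real \<Rightarrow> real \<Rightarrow> (real \<times> real \<Rightarrow> complex) set" where
  "B2 a b = {f. \<exists>D :: nat \<Rightarrow> nat \<Rightarrow> real \<times> real \<Rightarrow> complex.
     (\<forall>p \<in> Delta a b. D 0 0 p = f p) \<and>
     (\<forall>i j. continuous_on (Delta a b) (D i j)) \<and>
     (\<forall>i j. \<forall>(x, y) \<in> Delta a b.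
        ((\<lambda>s. D i j (s, y)) has_vector_derivative D (Suc i) j (x, y)) (at x within {y..b}) \<and>
        ((\<lambda>t. D i j (x, t)) has_vector_derivative D i (Suc j) (x, y)) (at y within {a..x}))}"

definition M_space :: "real \<Rightarrow> real \<Rightarrow> (real \<Rightarrow> complex) set" where
  "M_space a b = {\<phi> \<in> B1 a b. \<phi> a = 0 \<and> (\<forall>k\<ge>1. deriv_on a b k \<phi> a = 0)}"

end

theory Submission imports Defs begin

text \<open>
  Test the identity on functions \<open>\<phi>\<close> built from \<open>exp (- 1 / t)\<close>.

  The differential part of the operator is local and the integral part is not, and this separates
  them: if \<open>\<phi>\<close> is supported in \<open>[c, d]\<close> with \<open>a \<le> c < d \<le> x\<close>, all derivatives of \<open>\<phi>\<close> vanish at \<open>x\<close> and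
  only \<open>\<integral> f (x, z) \<phi> z dz = 0\<close> remains. A continuous kernel orthogonal to all bump functions is zero
  (\<open>kernel_eq_0\<close>), first inside the triangle and then on its boundary.

  What is left is a differential operator that kills every \<open>\<phi>\<close> flat at \<open>a\<close>. For \<open>x\<^sub>0 > a\<close> the
  function \<open>(x - x\<^sub>0)\<^sup>k exp (- 1 / (x - a))\<close>, extended by \<open>0\<close> to \<open>x \<le> a\<close>, is flat at \<open>a\<close>, and at \<open>x\<^sub>0\<close> its first derivative not to
  vanish is the \<open>k\<close>-th. With \<open>k\<close> the largest index such that \<open>P k x\<^sub>0 \<noteq> 0\<close>, only the \<open>k\<close>-th term of
  the operator survives at \<open>x\<^sub>0\<close>, a contradiction (\<open>coeffs_eq_0\<close>). The value at \<open>a\<close> follows by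
  continuity.
\<close>

section \<open>Flat functions and the smooth functions they generate\<close>

definition flat_exp :: "nat \<Rightarrow> real \<Rightarrow> real" where
  "flat_exp m t = (if t > 0 then exp (- 1 / t) / t ^ m else 0)"

lemma flat_exp_nonneg: "flat_exp m t \<ge> 0"
  by (simp add: flat_exp_def)

lemma flat_exp_pos: "t > 0 \<Longrightarrow> flat_exp m t > 0"
  by (simp add: flat_exp_def)

lemma flat_exp_eq_0: "t \<le> 0 \<Longrightarrow> flat_exp m t = 0"
  by (simp add: flat_exp_def)

text \<open>With \<open>u = 1 / t\<close> the limit from the right is that of \<open>u\<^sup>m / exp u\<close> at infinity.\<close>

lemma flat_exp_tendsto_0: "(flat_exp m \<longlongrightarrow> 0) (at 0)"
proof -
  have "((\<lambda>u::real. u ^ m / exp u) \<longlongrightarrow> 0) at_top"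
    by (rule tendsto_power_div_exp_0)
  moreover have "\<forall>\<^sub>F u in at_top. u ^ m / exp u = flat_exp m (inverse u)"
    using eventually_gt_at_top[of 0]
    by eventually_elim (simp add: flat_exp_def exp_minus field_simps)
  ultimately have right: "(flat_exp m \<longlongrightarrow> 0) (at_right 0)"
    unfolding filterlim_at_right_to_top by (rule Lim_transform_eventually)
  have "\<forall>\<^sub>F t in at_left 0. 0 = flat_exp m t"
    by (auto simp: eventually_at_filter flat_exp_eq_0)
  with tendsto_const have "(flat_exp m \<longlongrightarrow> 0) (at_left 0)"
    by (rule Lim_transform_eventually)
  with right show ?thesis
    by (simp add: filterlim_split_at)
qed

text \<open>
  The weights \<open>t\<^sup>-\<^sup>m\<close> make the family closed under differentiation; at \<open>0\<close> the difference quotient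
  of a member is the next member.
\<close>

lemma flat_exp_has_derivative:
  "(flat_exp m has_real_derivative flat_exp (m + 2) t - m * flat_exp (m + 1) t) (at t)"
proof -
  consider "t > 0" | "t < 0" | "t = 0" by linarith
  then show ?thesis
  proof cases
    case 1
    have "((\<lambda>t. exp (- 1 / t)) has_real_derivative exp (- 1 / t) / t\<^sup>2) (at t)"
      using 1 by (auto intro!: derivative_eq_intros simp: power2_eq_square)
    from DERIV_divide[OF this DERIV_pow[of m]] 1
    have "((\<lambda>t. exp (- 1 / t) / t ^ m) has_real_derivative
        (exp (- 1 / t) / t\<^sup>2 * t ^ m - exp (- 1 / t) * (real m * t ^ (m - 1))) / (t ^ m * t ^ m)) (at t)"
      by simp
    also have "(exp (- 1 / t) / t\<^sup>2 * t ^ m - exp (- 1 / t) * (real m * t ^ (m - 1))) / (t ^ m * t ^ m)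
        = flat_exp (m + 2) t - m * flat_exp (m + 1) t"
      using 1 by (cases m) (simp_all add: flat_exp_def field_simps power2_eq_square)
    finally show ?thesis
      by (rule has_field_derivative_transform_within_open[where S = "{0<..}"])
        (use 1 in \<open>auto simp: flat_exp_def\<close>)
  next
    case 2
    have "((\<lambda>t. 0) has_real_derivative flat_exp (m + 2) t - m * flat_exp (m + 1) t) (at t)"
      using 2 by (simp add: flat_exp_eq_0)
    then show ?thesis
      by (rule has_field_derivative_transform_within_open[where S = "{..<0}"])
        (use 2 in \<open>auto simp: flat_exp_eq_0\<close>)
  next
    case 3
    have "(\<lambda>h. (flat_exp m (0 + h) - flat_exp m 0) / h) = flat_exp (m + 1)"
      by (auto simp: flat_exp_def fun_eq_iff)
    then show ?thesis
      unfolding 3 DERIV_def using flat_exp_tendsto_0[of "m + 1"] by (simp add: flat_exp_eq_0)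
  qed
qed

text \<open>
  The generated algebra is closed under \<open>deriv\<close> by induction over the rules, so all its members are
  smooth; iterating first derivatives replaces the Leibniz formula.
\<close>

inductive flat_algebra :: "(real \<Rightarrow> real) \<Rightarrow> bool" where
  const: "flat_algebra (\<lambda>x. c)"
| ident: "flat_algebra (\<lambda>x. x)"
| flat: "flat_algebra (\<lambda>x. flat_exp m (s * x + t))"
| add: "flat_algebra g \<Longrightarrow> flat_algebra h \<Longrightarrow> flat_algebra (\<lambda>x. g x + h x)"
| mult: "flat_algebra g \<Longrightarrow> flat_algebra h \<Longrightarrow> flat_algebra (\<lambda>x. g x * h x)"

lemma flat_algebra_power: "flat_algebra g \<Longrightarrow> flat_algebra (\<lambda>x. g x ^ k)"
  by (induction k) (auto intro: flat_algebra.intros)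

lemma flat_algebra_derivative:
  "flat_algebra g \<Longrightarrow> \<exists>g'. flat_algebra g' \<and> (\<forall>x. (g has_real_derivative g' x) (at x))"
proof (induction rule: flat_algebra.induct)
  case (const c)
  show ?case by (rule exI[of _ "\<lambda>x. 0"]) (auto intro: flat_algebra.const)
next
  case ident
  show ?case by (rule exI[of _ "\<lambda>x. 1"]) (auto intro: flat_algebra.const)
next
  case (flat m s t)
  let ?g' = "\<lambda>x. (flat_exp (m + 2) (s * x + t) + (- real m) * flat_exp (m + 1) (s * x + t)) * s"
  have "flat_algebra ?g'"
    by (intro flat_algebra.intros)
  moreover have "((\<lambda>x. flat_exp m (s * x + t)) has_real_derivative ?g' x) (at x)" for x
  proof -
    have "((\<lambda>x. s * x + t) has_real_derivative s) (at x)"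
      by (auto intro!: derivative_eq_intros)
    from DERIV_chain2[OF flat_exp_has_derivative this] show ?thesis by simp
  qed
  ultimately show ?case by blast
next
  case (add g h)
  then obtain g' h' where "flat_algebra g'" "flat_algebra h'"
    "\<And>x. (g has_real_derivative g' x) (at x)" "\<And>x. (h has_real_derivative h' x) (at x)"
    by blast
  then show ?case
    by (intro exI[of _ "\<lambda>x. g' x + h' x"]) (auto intro!: flat_algebra.add DERIV_add)
next
  case (mult g h)
  then obtain g' h' where *: "flat_algebra g'" "flat_algebra h'"
    "\<And>x. (g has_real_derivative g' x) (at x)" "\<And>x. (h has_real_derivative h' x) (at x)"
    by blast
  then have "flat_algebra (\<lambda>x. g' x * h x + h' x * g x)"
    using mult.hyps by (intro flat_algebra.intros)
  then show ?case
    using *(3,4) DERIV_mult by blast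
qed

lemma flat_algebra_has_deriv:
  assumes "flat_algebra g"
  shows "(g has_real_derivative deriv g x) (at x)"
  using flat_algebra_derivative[OF assms] DERIV_imp_deriv by metis

lemma flat_algebra_deriv: "flat_algebra g \<Longrightarrow> flat_algebra (deriv g)"
  using flat_algebra_derivative[of g] DERIV_imp_deriv[of g] by (metis ext)

lemma flat_algebra_higher_deriv: "flat_algebra g \<Longrightarrow> flat_algebra ((deriv ^^ k) g)"
  by (induction k) (auto intro: flat_algebra_deriv)

lemma flat_algebra_continuous_on: "flat_algebra g \<Longrightarrow> continuous_on S g"
  by (meson DERIV_isCont continuous_at_imp_continuous_on flat_algebra_has_deriv)

text \<open>
  A one-sided derivative already determines the derivative, so the end points are included. This is
  where flatness at the edge of a support comes from.
\<close>

lemma higher_deriv_eq_0_on_interval: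
  assumes "flat_algebra g" "p < q" "\<And>x. x \<in> {p..q} \<Longrightarrow> g x = 0" "x \<in> {p..q}"
  shows "(deriv ^^ k) g x = 0"
  using assms(4)
proof (induction k arbitrary: x)
  case 0
  then show ?case using assms(3) by simp
next
  case (Suc k)
  let ?h = "(deriv ^^ k) g"
  have "(?h has_vector_derivative deriv ?h x) (at x within {p..q})"
    using flat_algebra_has_deriv[OF flat_algebra_higher_deriv[OF assms(1)]]
    by (simp add: has_real_derivative_iff_has_vector_derivative has_vector_derivative_at_within)
  moreover have "(?h has_vector_derivative 0) (at x within {p..q})"
    by (rule has_vector_derivative_transform[where f = "\<lambda>x. 0"]) (use Suc in auto)
  ultimately show ?case
    using vector_derivative_unique_within_closed_interval[OF assms(2), of x ?h] Suc.prems
    by simp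
qed

text \<open>
  Differentiating \<open>(x - x\<^sub>0)\<^bsup>k + 1\<^esup> g x\<close> gives \<open>(x - x\<^sub>0)\<^sup>k\<close> times a function of the same kind with value
  \<open>(k + 1) g x\<^sub>0\<close> at \<open>x\<^sub>0\<close>.
\<close>

lemma higher_deriv_at_zero_of_order:
  assumes "flat_algebra g" "i \<le> k"
  shows "(deriv ^^ i) (\<lambda>x. (x - x0) ^ k * g x) x0 = (if i = k then fact k * g x0 else 0)"
  using assms
proof (induction k arbitrary: g i)
  case 0
  then show ?case by simp
next
  case (Suc k)
  show ?case
  proof (cases i)
    case 0
    then show ?thesis by simp
  next
    case (Suc j)
    let ?h = "\<lambda>x. real (Suc k) * g x + (x + (- x0)) * deriv g x"
    have h: "flat_algebra ?h"
      using Suc.prems(1) flat_algebra_deriv by (intro flat_algebra.intros) auto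
    have "((\<lambda>x. (x - x0) ^ Suc k * g x) has_real_derivative (x - x0) ^ k * ?h x) (at x)" for x
      by (rule derivative_eq_intros refl flat_algebra_has_deriv[OF Suc.prems(1)])+
        (simp add: algebra_simps)
    then have "deriv (\<lambda>x. (x - x0) ^ Suc k * g x) = (\<lambda>x. (x - x0) ^ k * ?h x)"
      by (intro ext DERIV_imp_deriv)
    then have "(deriv ^^ i) (\<lambda>x. (x - x0) ^ Suc k * g x) x0
        = (deriv ^^ j) (\<lambda>x. (x - x0) ^ k * ?h x) x0"
      by (simp only: Suc funpow_Suc_right comp_apply)
    also have "\<dots> = (if j = k then fact k * ?h x0 else 0)"
      using Suc.IH[OF h, of j] Suc.prems Suc by simp
    finally show ?thesis
      by (simp add: Suc algebra_simps)
  qed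
qed

section \<open>Test functions on the interval\<close>

lemma flat_algebra_has_vector_derivative_of_real:
  assumes "flat_algebra g"
  shows "((\<lambda>x. complex_of_real (g x)) has_vector_derivative of_real (deriv g x)) (at x within S)"
  using has_vector_derivative_of_real[of g "deriv g x" "at x within S"]
    flat_algebra_has_deriv[OF assms, of x]
  by (simp add: has_field_derivative_at_within)

lemma deriv_on_of_real:
  assumes "flat_algebra g" "a < b" "x \<in> {a..b}"
  shows "deriv_on a b k (\<lambda>x. complex_of_real (g x)) x = of_real ((deriv ^^ k) g x)"
  using assms(3)
proof (induction k arbitrary: x)
  case 0
  then show ?case by (simp add: deriv_on_def)
next
  case (Suc k)
  let ?\<phi> = "\<lambda>x. complex_of_real (g x)"
  have "(deriv_on a b k ?\<phi> has_vector_derivative of_real (deriv ((deriv ^^ k) g) x))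
      (at x within {a..b})"
    by (rule has_vector_derivative_transform[OF Suc.prems Suc.IH
          flat_algebra_has_vector_derivative_of_real[OF flat_algebra_higher_deriv[OF assms(1)]]])
  then show ?case
    using vector_derivative_within_closed_interval[OF assms(2) Suc.prems]
    by (simp add: deriv_on_def)
qed

lemma of_real_in_M_space:
  assumes "flat_algebra g" "a < b" "\<And>x. x \<le> a \<Longrightarrow> g x = 0"
  shows "(\<lambda>x. complex_of_real (g x)) \<in> M_space a b"
proof -
  let ?\<phi> = "\<lambda>x. complex_of_real (g x)"
  have "deriv_on a b k ?\<phi> differentiable_on {a..b}" for k
    unfolding differentiable_on_def
  proof
    fix x assume x: "x \<in> {a..b}"
    have "(deriv_on a b k ?\<phi> has_vector_derivative of_real (deriv ((deriv ^^ k) g) x))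
        (at x within {a..b})"
      by (rule has_vector_derivative_transform[OF x deriv_on_of_real[OF assms(1,2)]
            flat_algebra_has_vector_derivative_of_real[OF flat_algebra_higher_deriv[OF assms(1)]]])
    then show "deriv_on a b k ?\<phi> differentiable (at x within {a..b})"
      by (rule differentiableI_vector)
  qed
  moreover have "deriv_on a b k ?\<phi> a = 0" for k
    using deriv_on_of_real[OF assms(1,2), of a k] assms(2)
      higher_deriv_eq_0_on_interval[OF assms(1), of "a - 1" a a k] assms(3)
    by simp
  ultimately show ?thesis
    using assms(3)[of a] by (simp add: M_space_def B1_def)
qed

section \<open>Separating the integral part from the differential part\<close>

text \<open>
  A bump placed where \<open>h\<close> is within less than a right angle of the direction of \<open>h y\<close> makes the real
  part of \<open>cnj (h y) * \<integral> h g\<close> positive.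
\<close>

lemma continuous_orthogonal_to_bumps_eq_0:
  fixes h :: "real \<Rightarrow> complex"
  assumes h: "continuous_on {a..x} h"
    and orth: "\<And>c d. a \<le> c \<Longrightarrow> c < d \<Longrightarrow> d \<le> x \<Longrightarrow>
      integral {a..x} (\<lambda>z. h z * of_real (flat_exp 0 (z - c) * flat_exp 0 (d - z))) = 0"
    and y: "a < y" "y < x"
  shows "h y = 0"
proof (rule ccontr)
  assume nz: "h y \<noteq> 0"
  define r where "r z = Re (cnj (h y) * h z)" for z
  have r: "continuous_on {a..x} r"
    unfolding r_def by (intro continuous_intros h)
  have "r y = (cmod (h y))\<^sup>2"
    using cmod_power2[of "h y"] by (simp add: r_def power2_eq_square)
  with nz have ry: "r y > 0" by simp
  obtain e where e: "e > 0" "\<And>z. z \<in> {a..x} \<Longrightarrow> dist z y < e \<Longrightarrow> dist (r z) (r y) < r y"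
    using r y ry unfolding continuous_on_iff by (metis atLeastAtMost_iff less_imp_le)
  define c d where "c = max a (y - e)" and "d = min x (y + e)"
  have cd: "a \<le> c" "c < y" "y < d" "d \<le> x"
    using y e(1) by (auto simp: c_def d_def)
  define g where "g z = flat_exp 0 (z - c) * flat_exp 0 (d - z)" for z
  have "flat_algebra (\<lambda>z. flat_exp 0 (1 * z + (- c)) * flat_exp 0 ((-1) * z + d))"
    by (intro flat_algebra.intros)
  then have "flat_algebra g"
    by (simp add: g_def[abs_def])
  then have g: "continuous_on {a..x} g"
    by (rule flat_algebra_continuous_on)
  have nonneg: "r z * g z \<ge> 0" if "z \<in> {a..x}" for z
  proof (cases "c < z \<and> z < d")
    case True
    then have "dist z y < e"
      by (auto simp: c_def d_def dist_real_def)
    with e(2)[OF that] have "r z > 0"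
      by (auto simp: dist_real_def)
    then show ?thesis
      by (simp add: g_def flat_exp_nonneg)
  next
    case False
    then show ?thesis
      by (auto simp: g_def flat_exp_eq_0)
  qed
  have "(\<lambda>z. h z * of_real (g z)) integrable_on {a..x}"
    by (intro integrable_continuous_interval continuous_intros h g)
  moreover have "integral {a..x} (\<lambda>z. h z * of_real (g z)) = 0"
    using orth[of c d] cd by (simp add: g_def)
  ultimately have "((\<lambda>z. h z * of_real (g z)) has_integral 0) {a..x}"
    by (metis integrable_integral)
  moreover have "bounded_linear (\<lambda>w. Re (cnj (h y) * w))"
    by (rule bounded_linear_compose[OF bounded_linear_Re bounded_linear_mult_right])
  ultimately have "((\<lambda>z. Re (cnj (h y) * (h z * of_real (g z)))) has_integral Re (cnj (h y) * 0)) {a..x}"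
    using has_integral_linear[unfolded o_def] by blast
  then have "((\<lambda>z. r z * g z) has_integral 0) {a..x}"
    by (simp add: r_def algebra_simps)
  then have "integral {a..x} (\<lambda>z. r z * g z) = 0"
    by (rule integral_unique)
  then have "r y * g y = 0"
    using integral_eq_0_iff[OF continuous_on_mult[OF r g]] nonneg y by simp
  moreover have "g y > 0"
    using cd by (simp add: g_def flat_exp_pos)
  ultimately show False
    using ry by simp
qed

lemma continuous_eq_0_on_closure_open_interval:
  fixes h :: "real \<Rightarrow> complex"
  assumes "continuous_on {p..q} h" "p < q" "\<And>x. p < x \<Longrightarrow> x < q \<Longrightarrow> h x = 0" "x \<in> {p..q}"
  shows "h x = 0"
  using continuous_constant_on_closure[of "{p<..<q}" h 0 x] assms by simp

lemma B2_imp_continuous_on: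
  assumes "f \<in> B2 a b"
  shows "continuous_on (Delta a b) f"
proof -
  obtain D :: "nat \<Rightarrow> nat \<Rightarrow> real \<times> real \<Rightarrow> complex"
    where "\<forall>p \<in> Delta a b. D 0 0 p = f p" "continuous_on (Delta a b) (D 0 0)"
    using assms unfolding B2_def by blast
  then show ?thesis
    by (simp cong: continuous_on_cong)
qed

lemma kernel_eq_0:
  fixes P :: "nat \<Rightarrow> real \<Rightarrow> complex" and f :: "real \<times> real \<Rightarrow> complex"
  assumes ab: "a < b" and f: "continuous_on (Delta a b) f"
    and ann: "\<And>\<phi> x. \<phi> \<in> M_space a b \<Longrightarrow> x \<in> {a..b} \<Longrightarrow>
           (\<Sum>i\<le>n. P i x * deriv_on a b i \<phi> x)
             + integral {a..x} (\<lambda>z. f (x, z) * \<phi> z) = 0"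
    and xy: "(x, y) \<in> Delta a b"
  shows "f (x, y) = 0"
proof -
  have row: "f (x, y) = 0" if "a < x" "x \<le> b" "y \<in> {a..x}" for x y
  proof -
    have cont: "continuous_on {a..x} (\<lambda>z. f (x, z))"
      by (rule continuous_on_compose2[OF f]) (use that in \<open>auto simp: Delta_def intro!: continuous_intros\<close>)
    have orth: "integral {a..x} (\<lambda>z. f (x, z) * of_real (flat_exp 0 (z - c) * flat_exp 0 (d - z))) = 0"
      if cd: "a \<le> c" "c < d" "d \<le> x" for c d
    proof -
      define g where "g z = flat_exp 0 (z - c) * flat_exp 0 (d - z)" for z
      have "flat_algebra (\<lambda>z. flat_exp 0 (1 * z + (- c)) * flat_exp 0 ((-1) * z + d))"
        by (intro flat_algebra.intros)
      then have g: "flat_algebra g"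
        by (simp add: g_def[abs_def])
      have "(\<lambda>z. complex_of_real (g z)) \<in> M_space a b"
        using cd by (intro of_real_in_M_space g ab) (simp add: g_def flat_exp_eq_0)
      from ann[OF this, of x]
      have "(\<Sum>i\<le>n. P i x * deriv_on a b i (\<lambda>z. complex_of_real (g z)) x)
             + integral {a..x} (\<lambda>z. f (x, z) * of_real (g z)) = 0"
        using \<open>a < x\<close> \<open>x \<le> b\<close> by simp
      moreover have "deriv_on a b i (\<lambda>z. complex_of_real (g z)) x = 0" for i
      proof -
        have "(deriv ^^ i) g x = 0"
          using cd by (intro higher_deriv_eq_0_on_interval[OF g, of x "x + 1"])
            (auto simp: g_def flat_exp_eq_0)
        then show ?thesis
          using \<open>a < x\<close> \<open>x \<le> b\<close> by (simp add: deriv_on_of_real[OF g ab])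
      qed
      ultimately show ?thesis by (simp add: g_def)
    qed
    show ?thesis
      using continuous_eq_0_on_closure_open_interval[OF cont \<open>a < x\<close>] \<open>y \<in> {a..x}\<close>
        continuous_orthogonal_to_bumps_eq_0[OF cont orth] by blast
  qed
  show ?thesis
  proof (cases "a < x")
    case True
    then show ?thesis using row xy by (simp add: Delta_def)
  next
    \<comment> \<open>The row over \<open>x = a\<close> is a single point; it is reached along the edge \<open>y = a\<close>.\<close>
    case False
    then have "x = a" "y = a" using xy by (auto simp: Delta_def)
    moreover have "continuous_on {a..b} (\<lambda>s. f (s, a))"
      by (rule continuous_on_compose2[OF f]) (auto simp: Delta_def intro!: continuous_intros)
    from continuous_eq_0_on_closure_open_interval[OF this ab, of a] row ab
    have "f (a, a) = 0" by simp
    ultimately show ?thesis by simp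
  qed
qed

section \<open>Vanishing of the coefficients\<close>

lemma coeffs_eq_0:
  fixes P :: "nat \<Rightarrow> real \<Rightarrow> complex"
  assumes ab: "a < b" and x0: "a < x0" "x0 \<le> b"
    and ann: "\<And>\<phi>. \<phi> \<in> M_space a b \<Longrightarrow> (\<Sum>i\<le>n. P i x0 * deriv_on a b i \<phi> x0) = 0"
    and "i \<le> n"
  shows "P i x0 = 0"
proof (rule ccontr)
  assume nz: "P i x0 \<noteq> 0"
  define k where "k = Max {i. i \<le> n \<and> P i x0 \<noteq> 0}"
  have fin: "finite {i. i \<le> n \<and> P i x0 \<noteq> 0}" by simp
  have "k \<in> {i. i \<le> n \<and> P i x0 \<noteq> 0}"
    unfolding k_def by (rule Max_in[OF fin]) (use nz \<open>i \<le> n\<close> in auto)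
  then have k: "k \<le> n" "P k x0 \<noteq> 0" by auto
  have above: "P j x0 = 0" if "k < j" "j \<le> n" for j
    using Max_ge[OF fin, of j] that unfolding k_def by fastforce
  have "flat_algebra (\<lambda>x. flat_exp 0 (1 * x + (- a)))"
    by (rule flat_algebra.flat)
  then have \<chi>: "flat_algebra (\<lambda>x. flat_exp 0 (x - a))" by simp
  define g where "g x = (x - x0) ^ k * flat_exp 0 (x - a)" for x
  have "flat_algebra (\<lambda>x. (x + (- x0)) ^ k * flat_exp 0 (x - a))"
    by (intro flat_algebra.intros flat_algebra_power \<chi>)
  then have g: "flat_algebra g"
    by (simp add: g_def[abs_def])
  have "(\<lambda>x. complex_of_real (g x)) \<in> M_space a b"
    by (intro of_real_in_M_space g ab) (simp add: g_def flat_exp_eq_0)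
  from ann[OF this] have "(\<Sum>i\<le>n. P i x0 * of_real ((deriv ^^ i) g x0)) = 0"
    using x0 by (simp add: deriv_on_of_real[OF g ab])
  moreover have "P i x0 * of_real ((deriv ^^ i) g x0)
      = (if i = k then P k x0 * of_real (fact k * flat_exp 0 (x0 - a)) else 0)" if "i \<le> n" for i
    using above[of i] that higher_deriv_at_zero_of_order[OF \<chi>, of i k x0]
    by (cases "k < i") (auto simp: g_def[abs_def])
  ultimately have "P k x0 * of_real (fact k * flat_exp 0 (x0 - a)) = 0"
    using k by simp
  then show False
    using k flat_exp_pos[of "x0 - a" 0] x0 by simp
qed

lemma B1_imp_continuous_on: "p \<in> B1 a b \<Longrightarrow> continuous_on {a..b} p"
  unfolding B1_def deriv_on_def
  using differentiable_imp_continuous_on by (metis (mono_tags, lifting) eq_id_iff funpow_0 mem_Collect_eq)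

theorem theorem1:
  fixes a b :: real and n :: nat
    and P :: "nat \<Rightarrow> real \<Rightarrow> complex" and f :: "real \<times> real \<Rightarrow> complex"
  assumes "a < b" and "n \<ge> 1"
    and "\<And>i. i \<le> n \<Longrightarrow> P i \<in> B1 a b"
    and "f \<in> B2 a b"
    and "\<And>\<phi> x. \<phi> \<in> M_space a b \<Longrightarrow> x \<in> {a..b} \<Longrightarrow>
           (\<Sum>i=1..n. P i x * deriv_on a b i \<phi> x) + P 0 x * \<phi> x
             + integral {a..x} (\<lambda>z. f (x, z) * \<phi> z) = 0"
  shows "(\<forall>i\<le>n. \<forall>x\<in>{a..b}. P i x = 0) \<and> (\<forall>(x, y)\<in>Delta a b. f (x, y) = 0)"
proof -
  have "(\<Sum>i\<le>n. P i x * deriv_on a b i \<phi> x)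
      = (\<Sum>i=1..n. P i x * deriv_on a b i \<phi> x) + P 0 x * \<phi> x" for \<phi> x
    by (simp add: sum.atMost_shift sum.shift_bounds_cl_Suc_ivl deriv_on_def
        atLeast0LessThan[symmetric] atLeastLessThanSuc_atLeastAtMost[symmetric]
        sum.shift_bounds_Suc_ivl del: sum.op_ivl_Suc)
  with assms(5) have ann: "(\<Sum>i\<le>n. P i x * deriv_on a b i \<phi> x)
      + integral {a..x} (\<lambda>z. f (x, z) * \<phi> z) = 0" if "\<phi> \<in> M_space a b" "x \<in> {a..b}" for \<phi> x
    using that by simp
  have f0: "f (x, y) = 0" if "(x, y) \<in> Delta a b" for x y
    by (rule kernel_eq_0[OF assms(1) B2_imp_continuous_on[OF assms(4)] ann that])
  have diff0: "(\<Sum>i\<le>n. P i x * deriv_on a b i \<phi> x) = 0"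
    if "\<phi> \<in> M_space a b" "x \<in> {a..b}" for \<phi> x
  proof -
    have "integral {a..x} (\<lambda>z. f (x, z) * \<phi> z) = integral {a..x} (\<lambda>z. 0)"
      by (rule integral_cong) (use f0 that(2) in \<open>auto simp: Delta_def\<close>)
    then show ?thesis using ann[OF that] by simp
  qed
  have inner: "P i x = 0" if "i \<le> n" "a < x" "x \<le> b" for i x
  proof (rule coeffs_eq_0[OF assms(1) that(2,3) _ that(1)])
    show "(\<Sum>i\<le>n. P i x * deriv_on a b i \<phi> x) = 0" if "\<phi> \<in> M_space a b" for \<phi>
      using diff0[OF that] \<open>a < x\<close> \<open>x \<le> b\<close> by simp
  qed
  have "P i x = 0" if "i \<le> n" "x \<in> {a..b}" for i x
    by (rule continuous_eq_0_on_closure_open_interval[OF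
          B1_imp_continuous_on[OF assms(3)[OF that(1)]] assms(1) _ that(2)])
      (use inner that(1) in auto)
  with f0 show ?thesis by auto
qed

end
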